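(* Let $k$ be a field of characteristic zero, let $\Delta$ be a simplicial complex on the vertex set $V=\{x_1,\ldots,x_n\}$ with set of facets $\mathcal{F}(\Delta)$ and no facet of cardinality one, and let $A=A(\Delta,a_1,\ldots,a_n)$ with $a_i\geq 2$ for all $i$. Then the minimal generators of the inverse system corresponding to $A$ are the elements of the set $$\Big\{\prod_{x_i\in F} y_i^{a_i-1} \;\Big|\; F\in\mathcal{F}(\Delta)\Big\}.$$ In particular, if $s(A)=(s_0,\ldots,s_e)$ is the socle-vector of $A$, then for each $j$ $$s_j=\#\Big\{F\in\mathcal{F}(\Delta) \;\Big|\; \sum_{x_i\in F}(a_i-1)=j\Big\}.$$
   Context: A simplicial complex $\Delta$ on $V=\{x_1,\ldots,x_n\}$ ($n\ge 1$) is a collection of subsets of $V$ (faces) closed under taking subsets and with $\{x_i\}\in\Delta$ for all $i$; its facets are its faces that are maximal under inclusion. Let $R=k[x_1,\ldots,x_n]$ with $\deg x_i=1$. The Stanley-Reisner ideal is $I_\Delta=(x_{i_1}\cdots x_{i_s} \mid \{x_{i_1},\ldots,x_{i_s}\}\notin\Delta)\subseteq R$ (squarefree monomials). For integers $a_i\ge 2$, set $A(\Delta,a_1,\ldots,a_n)=R/(I_\Delta+(x_1^{a_1},\ldots,x_n^{a_n}))$, a graded artinian algebra. Inverse systems: let $S=k[y_1,\ldots,y_n]$ be the $R$-module on which $x_i$ acts as the partial derivative $\partial/\partial y_i$. The inverse system of $A=R/I$ is the $R$-submodule $M=I^{-1}=\{g\in S\mid f\cdot g=0 \text{ for all } f\in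 I\}$ of $S$. When $I$ is a monomial ideal, $M$ is generated by monomials; its minimal generators are the monomials forming a minimal generating set of $M$ as an $R$-module (unique up to nonzero scalars). Socle: $\operatorname{soc}(A)=\{a\in A\mid a\overline{x}_i=0 \text{ for all } i\}$, a homogeneous ideal. The socle-vector of $A$ is $s(A)=(s_0,\ldots,s_e)$ with $s_i=\dim_k \operatorname{soc}(A)_i$, where $e$ is the largest index with $A_e\neq 0$. *)

theory Defs
  imports
    "HOL-Library.Poly_Mapping"
    "HOL-Library.More_List"
    "HOL-Algebra.QuotRing"
    "HOL-Algebra.Embedded_Algebras"
begin

section \<open>Simplicial complexes\<close>

text \<open>The vertex set is the whole (finite, nonempty) type \<open>'v\<close>, so that
  \<open>n = CARD('v) \<ge> 1\<close>.\<close>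

definition simplicial_complex :: "'v::finite set set \<Rightarrow> bool" where
  "simplicial_complex \<Delta> \<longleftrightarrow> (\<forall>F\<in>\<Delta>. \<forall>G. G \<subseteq> F \<longrightarrow> G \<in> \<Delta>) \<and> (\<forall>i. {i} \<in> \<Delta>)"

definition facets :: "'v set set \<Rightarrow> 'v set set" where
  "facets \<Delta> = {F \<in> \<Delta>. \<forall>G\<in>\<Delta>. F \<subseteq> G \<longrightarrow> G = F}"


section \<open>The polynomial ring and its quotients\<close>

text \<open>A polynomial maps exponent vectors to coefficients; multiplication is the convolution
  product of \<^theory>\<open>HOL-Library.Poly_Mapping\<close>. This type serves both as
  \<open>R = k[x\<^sub>1,\<dots>,x\<^sub>n]\<close> and as \<open>S = k[y\<^sub>1,\<dots>,y\<^sub>n]\<close>.\<close>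

type_synonym ('v, 'k) mpoly = "('v \<Rightarrow>\<^sub>0 nat) \<Rightarrow>\<^sub>0 'k"

definition monomial :: "('v \<Rightarrow>\<^sub>0 nat) \<Rightarrow> ('v, 'k::field) mpoly" where
  "monomial b = Poly_Mapping.single b 1"

definition var :: "'v \<Rightarrow> ('v, 'k::field) mpoly" where
  "var i = monomial (Poly_Mapping.single i 1)"

definition const :: "'k \<Rightarrow> ('v, 'k::field) mpoly" where
  "const c = Poly_Mapping.single 0 c"

definition homogeneous :: "nat \<Rightarrow> ('v::finite, 'k::field) mpoly \<Rightarrow> bool" where
  "homogeneous j f \<longleftrightarrow> (\<forall>b\<in>Poly_Mapping.keys f. (\<Sum>i\<in>UNIV. Poly_Mapping.lookup b i) = j)"

definition mpoly_ring :: "('v, 'k::field) mpoly ring" where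
  "mpoly_ring = \<lparr>carrier = UNIV, mult = (*), one = 1, zero = 0, add = (+)\<rparr>"

lemma cring_mpoly_ring: "cring (mpoly_ring :: ('v, 'k::field) mpoly ring)"
proof (rule cringI)
  show "abelian_group (mpoly_ring :: ('v, 'k) mpoly ring)"
  proof (rule abelian_groupI)
    fix x :: "('v, 'k) mpoly"
    show "\<exists>y\<in>carrier mpoly_ring. y \<oplus>\<^bsub>mpoly_ring\<^esub> x = \<zero>\<^bsub>mpoly_ring\<^esub>"
      by (rule bexI[of _ "- x"]) (simp_all add: mpoly_ring_def)
  qed (simp_all add: mpoly_ring_def algebra_simps)
  show "comm_monoid (mpoly_ring :: ('v, 'k) mpoly ring)"
    by (rule comm_monoidI) (simp_all add: mpoly_ring_def algebra_simps)
qed (simp add: mpoly_ring_def algebra_simps)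

definition stanley_reisner_ideal :: "'v::finite set set \<Rightarrow> ('v, 'k::field) mpoly set" where
  "stanley_reisner_ideal \<Delta> = Idl\<^bsub>mpoly_ring\<^esub> {\<Prod>i\<in>F. var i | F. F \<notin> \<Delta>}"

definition power_ideal :: "('v::finite \<Rightarrow> nat) \<Rightarrow> ('v, 'k::field) mpoly set" where
  "power_ideal a = Idl\<^bsub>mpoly_ring\<^esub> {var i ^ a i | i. True}"

text \<open>The ideal \<open>I\<close> with \<open>A(\<Delta>, a\<^sub>1, \<dots>, a\<^sub>n) = R/I\<close>. The notions below depend on the
  presentation \<open>R/I\<close> of the algebra (its grading, the classes of the variables, its inverse
  system) and hence take \<open>I\<close> as their argument.\<close>

definition defining_ideal ::
    "'v::finite set set \<Rightarrow> ('v \<Rightarrow> nat) \<Rightarrow> ('v, 'k::field) mpoly set" where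
  "defining_ideal \<Delta> a = stanley_reisner_ideal \<Delta> <+>\<^bsub>mpoly_ring\<^esub> power_ideal a"

definition quot_alg :: "('v, 'k::field) mpoly set \<Rightarrow> ('v, 'k) mpoly set ring" where
  "quot_alg I = mpoly_ring Quot I"

definition residue_class ::
    "('v, 'k::field) mpoly set \<Rightarrow> ('v, 'k) mpoly \<Rightarrow> ('v, 'k) mpoly set" where
  "residue_class I f = I +>\<^bsub>mpoly_ring\<^esub> f"

definition scalars :: "('v, 'k::field) mpoly set \<Rightarrow> ('v, 'k) mpoly set set" where
  "scalars I = {residue_class I (const c) | c. True}"

definition graded_part ::
    "('v::finite, 'k::field) mpoly set \<Rightarrow> nat \<Rightarrow> ('v, 'k) mpoly set set" where
  "graded_part I j = {residue_class I f | f. homogeneous j f}"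


section \<open>Socle and socle-vector\<close>

definition socle :: "('v, 'k::field) mpoly set \<Rightarrow> ('v, 'k) mpoly set set" where
  "socle I = {p \<in> carrier (quot_alg I).
     \<forall>i. p \<otimes>\<^bsub>quot_alg I\<^esub> residue_class I (var i) = \<zero>\<^bsub>quot_alg I\<^esub>}"

definition top_degree :: "('v::finite, 'k::field) mpoly set \<Rightarrow> nat" where
  "top_degree I = (GREATEST j. graded_part I j \<noteq> {\<zero>\<^bsub>quot_alg I\<^esub>})"

definition socle_vector :: "('v::finite, 'k::field) mpoly set \<Rightarrow> nat list" where
  "socle_vector I =
     map (\<lambda>j. ring.dim (quot_alg I) (scalars I) (socle I \<inter> graded_part I j))
       [0..<Suc (top_degree I)]"


section \<open>Inverse systems\<close>

definition partial_deriv :: "'v \<Rightarrow> ('v, 'k::field) mpoly \<Rightarrow> ('v, 'k) mpoly" where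
  "partial_deriv i g =
     (\<Sum>b\<in>Poly_Mapping.keys g.
       Poly_Mapping.single (b - Poly_Mapping.single i 1)
         (of_nat (Poly_Mapping.lookup b i) * Poly_Mapping.lookup g b))"

text \<open>The order in which \<open>fold\<close> applies the partial derivatives is irrelevant, since they commute
  (see \<open>lookup_monomial_deriv\<close>).\<close>

definition monomial_deriv :: "('v::finite \<Rightarrow>\<^sub>0 nat) \<Rightarrow> ('v, 'k::field) mpoly \<Rightarrow> ('v, 'k) mpoly" where
  "monomial_deriv b g = Finite_Set.fold (\<lambda>i. partial_deriv i ^^ Poly_Mapping.lookup b i) g UNIV"

lemma poly_mapping_sum_single:
  "f = (\<Sum>b\<in>Poly_Mapping.keys f. Poly_Mapping.single b (Poly_Mapping.lookup f b))"
  by (rule poly_mapping_eqI)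
     (simp add: lookup_sum lookup_single when_def in_keys_iff)

lemma lookup_const_mult: "Poly_Mapping.lookup (const c * g) b = c * Poly_Mapping.lookup g b"
proof -
  have "const c * g =
      (\<Sum>b\<in>Poly_Mapping.keys g. Poly_Mapping.single b (c * Poly_Mapping.lookup g b))"
    using arg_cong[OF poly_mapping_sum_single[of g], of "\<lambda>g. const c * g"]
    by (simp only: sum_distrib_left const_def mult_single add_0_left)
  then show ?thesis
    by (simp add: lookup_sum lookup_single when_def in_keys_iff)
qed

lemma lookup_partial_deriv:
  "Poly_Mapping.lookup (partial_deriv i g) c =
     of_nat (Suc (Poly_Mapping.lookup c i)) * Poly_Mapping.lookup g (c + Poly_Mapping.single i 1)"
proof -
  let ?e = "Poly_Mapping.single i (1::nat)"
  have eq: "b = c + ?e" if "b - ?e = c" "Poly_Mapping.lookup b i \<noteq> 0" for b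
  proof (rule poly_mapping_eqI)
    fix j
    show "Poly_Mapping.lookup b j = Poly_Mapping.lookup (c + ?e) j"
      using that by (auto simp: lookup_add lookup_minus lookup_single when_def)
  qed
  have "Poly_Mapping.lookup (partial_deriv i g) c =
      (\<Sum>b\<in>Poly_Mapping.keys g. if b = c + ?e
         then of_nat (Poly_Mapping.lookup b i) * Poly_Mapping.lookup g b else 0)"
    unfolding partial_deriv_def lookup_sum
  proof (rule sum.cong)
    fix b
    show "Poly_Mapping.lookup (Poly_Mapping.single (b - ?e)
          (of_nat (Poly_Mapping.lookup b i) * Poly_Mapping.lookup g b)) c =
        (if b = c + ?e then of_nat (Poly_Mapping.lookup b i) * Poly_Mapping.lookup g b else 0)"
    proof (cases "Poly_Mapping.lookup b i = 0")
      case False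
      then have "b - ?e = c \<longleftrightarrow> b = c + ?e"
        using eq by auto
      then show ?thesis
        by (simp only: lookup_single when_def)
    next
      case True
      then show ?thesis
        by (simp only: of_nat_0 mult_zero_left single_zero lookup_zero if_cancel)
    qed
  qed simp
  then show ?thesis
    by (simp add: in_keys_iff lookup_add)
qed

lemma lookup_partial_deriv_funpow:
  "Poly_Mapping.lookup ((partial_deriv i ^^ m) g) c =
     pochhammer (of_nat (Suc (Poly_Mapping.lookup c i))) m *
     Poly_Mapping.lookup g (c + Poly_Mapping.single i m)"
proof (induction m arbitrary: c)
  case (Suc m)
  have "Poly_Mapping.single i 1 + Poly_Mapping.single i m = Poly_Mapping.single i (Suc m)"
    by (simp add: single_add[symmetric])
  then show ?case
    by (simp add: lookup_partial_deriv Suc pochhammer_rec lookup_add ac_simps)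
qed simp

lemma lookup_monomial_deriv:
  fixes b :: "'v::finite \<Rightarrow>\<^sub>0 nat" and g :: "('v, 'k::field) mpoly"
  shows "Poly_Mapping.lookup (monomial_deriv b g) c =
     (\<Prod>i\<in>UNIV. pochhammer (of_nat (Suc (Poly_Mapping.lookup c i))) (Poly_Mapping.lookup b i)) *
     Poly_Mapping.lookup g (c + b)"
proof -
  let ?f = "\<lambda>i. partial_deriv i ^^ Poly_Mapping.lookup b i :: ('v, 'k) mpoly \<Rightarrow> _"
  interpret comp_fun_commute_on UNIV ?f
  proof
    fix i j
    show "?f j \<circ> ?f i = ?f i \<circ> ?f j"
    proof (cases "i = j")
      case False
      have "Poly_Mapping.lookup (?f j (?f i h)) c = Poly_Mapping.lookup (?f i (?f j h)) c" for h c
      proof -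
        have "Poly_Mapping.lookup (c + Poly_Mapping.single i m) j = Poly_Mapping.lookup c j"
          and "Poly_Mapping.lookup (c + Poly_Mapping.single j m) i = Poly_Mapping.lookup c i" for m
          using False by (simp_all add: lookup_add lookup_single)
        then show ?thesis
          by (simp only: lookup_partial_deriv_funpow ac_simps)
      qed
      then show ?thesis
        by (intro ext poly_mapping_eqI) simp
    qed simp
  qed
  have "Poly_Mapping.lookup (Finite_Set.fold ?f g F) c =
     (\<Prod>i\<in>F. pochhammer (of_nat (Suc (Poly_Mapping.lookup c i))) (Poly_Mapping.lookup b i)) *
     Poly_Mapping.lookup g (c + (\<Sum>i\<in>F. Poly_Mapping.single i (Poly_Mapping.lookup b i)))" for F
    using finite[of F]
  proof (induction F arbitrary: c rule: finite_induct)
    case (insert i F)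
    let ?c = "c + Poly_Mapping.single i (Poly_Mapping.lookup b i)"
    have "(\<Prod>j\<in>F. pochhammer (of_nat (Suc (Poly_Mapping.lookup ?c j)) :: 'k)
            (Poly_Mapping.lookup b j)) =
        (\<Prod>j\<in>F. pochhammer (of_nat (Suc (Poly_Mapping.lookup c j))) (Poly_Mapping.lookup b j))"
      using insert.hyps by (intro prod.cong) (auto simp: lookup_add lookup_single when_def)
    moreover have "Finite_Set.fold ?f g (insert i F) = ?f i (Finite_Set.fold ?f g F)"
      using insert.hyps by (intro fold_insert) simp_all
    ultimately show ?case
      by (simp only: lookup_partial_deriv_funpow insert.IH prod.insert[OF insert.hyps]
          sum.insert[OF insert.hyps] add.assoc mult.assoc)
  qed simp
  moreover have "(\<Sum>i\<in>UNIV. Poly_Mapping.single i (Poly_Mapping.lookup b i)) = b"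
    by (rule poly_mapping_eqI) (simp add: lookup_sum lookup_single when_def)
  ultimately show ?thesis
    unfolding monomial_deriv_def by simp
qed

definition diff_act :: "('v::finite, 'k::field) mpoly \<Rightarrow> ('v, 'k) mpoly \<Rightarrow> ('v, 'k) mpoly" where
  "diff_act f g = (\<Sum>b\<in>Poly_Mapping.keys f. const (Poly_Mapping.lookup f b) * monomial_deriv b g)"

lemma diff_act_single:
  "diff_act (Poly_Mapping.single b c) g = const c * monomial_deriv b g"
  by (cases "c = 0") (simp_all add: diff_act_def const_def)

lemma monomial_deriv_single_one: "monomial_deriv (Poly_Mapping.single i 1) g = partial_deriv i g"
proof (rule poly_mapping_eqI)
  fix c
  have "(\<Prod>j\<in>UNIV. pochhammer (of_nat (Suc (Poly_Mapping.lookup c j)) :: 'b)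
          (Poly_Mapping.lookup (Poly_Mapping.single i 1) j)) =
        (\<Prod>j\<in>UNIV. if j = i then of_nat (Suc (Poly_Mapping.lookup c j)) else 1)"
    by (rule prod.cong) (auto simp: lookup_single when_def)
  then show "Poly_Mapping.lookup (monomial_deriv (Poly_Mapping.single i 1) g) c =
      Poly_Mapping.lookup (partial_deriv i g) c"
    unfolding lookup_monomial_deriv lookup_partial_deriv by simp
qed

lemma diff_act_var: "diff_act (var i) g = partial_deriv i g"
  unfolding var_def monomial_def diff_act_single monomial_deriv_single_one
  by (simp add: const_def)

lemma monomial_deriv_plus: "monomial_deriv (a + b) g = monomial_deriv a (monomial_deriv b g)"
proof (rule poly_mapping_eqI)
  fix c
  have "(\<Prod>i\<in>UNIV. pochhammer (of_nat (Suc (Poly_Mapping.lookup c i)) :: 'b)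
          (Poly_Mapping.lookup (a + b) i)) =
      (\<Prod>i\<in>UNIV. pochhammer (of_nat (Suc (Poly_Mapping.lookup c i))) (Poly_Mapping.lookup a i)) *
      (\<Prod>i\<in>UNIV. pochhammer (of_nat (Suc (Poly_Mapping.lookup (c + a) i))) (Poly_Mapping.lookup b i))"
    unfolding prod.distrib[symmetric]
    by (rule prod.cong) (simp_all add: lookup_add pochhammer_product' add.assoc)
  then show "Poly_Mapping.lookup (monomial_deriv (a + b) g) c =
      Poly_Mapping.lookup (monomial_deriv a (monomial_deriv b g)) c"
    by (simp only: lookup_monomial_deriv mult.assoc add.assoc)
qed

lemma monomial_deriv_const_mult: "monomial_deriv b (const c * g) = const c * monomial_deriv b g"
  by (rule poly_mapping_eqI) (simp add: lookup_monomial_deriv lookup_const_mult)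

lemma diff_act_add_left: "diff_act (f + h) g = diff_act f g + diff_act h g"
  unfolding diff_act_def
  by (rule setsum_keys_plus_distrib) (simp_all add: const_def single_add distrib_right)

lemma diff_act_add_right: "diff_act f (g + h) = diff_act f g + diff_act f h"
proof -
  have "monomial_deriv b (g + h) = monomial_deriv b g + monomial_deriv b h" for b
    by (rule poly_mapping_eqI) (simp add: lookup_monomial_deriv lookup_add distrib_left)
  then show ?thesis
    by (simp add: diff_act_def distrib_left sum.distrib)
qed

lemma diff_act_sum_left: "diff_act (sum f A) g = (\<Sum>x\<in>A. diff_act (f x) g)"
  by (induction A rule: infinite_finite_induct)
     (simp_all add: diff_act_add_left diff_act_def[of 0])

lemma diff_act_sum_right: "diff_act f (sum g A) = (\<Sum>x\<in>A. diff_act f (g x))"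
proof -
  have "diff_act f 0 = 0"
    using diff_act_add_right[of f 0 0] by simp
  then show ?thesis
    by (induction A rule: infinite_finite_induct) (simp_all add: diff_act_add_right)
qed

lemma module_diff_act: "Modules.module diff_act"
proof
  fix f h g :: "('a, 'b) mpoly"
  show "diff_act f (g + h) = diff_act f g + diff_act f h"
    by (rule diff_act_add_right)
  show "diff_act (f + h) g = diff_act f g + diff_act h g"
    by (rule diff_act_add_left)
  have one: "const 1 = (1 :: ('a, 'b) mpoly)"
    by (simp add: const_def)
  have "diff_act (Poly_Mapping.single 0 1) g = g"
    unfolding diff_act_single one
    by (rule poly_mapping_eqI) (simp add: lookup_monomial_deriv)
  then show "diff_act 1 g = g"
    by simp
  have single: "diff_act (Poly_Mapping.single b c) (diff_act (Poly_Mapping.single b' c') g) =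
      diff_act (Poly_Mapping.single b c * Poly_Mapping.single b' c') g"
    for b b' :: "'a \<Rightarrow>\<^sub>0 nat" and c c' :: 'b
  proof -
    have "const (c * c') = (const c * const c' :: ('a, 'b) mpoly)"
      by (simp add: const_def mult_single)
    then show ?thesis
      by (simp add: mult_single diff_act_single monomial_deriv_plus monomial_deriv_const_mult
          mult.assoc)
  qed
  let ?f = "\<Sum>b\<in>Poly_Mapping.keys f. Poly_Mapping.single b (Poly_Mapping.lookup f b)"
  let ?h = "\<Sum>b\<in>Poly_Mapping.keys h. Poly_Mapping.single b (Poly_Mapping.lookup h b)"
  have "diff_act ?f (diff_act ?h g) = diff_act (?f * ?h) g"
    unfolding sum_product diff_act_sum_left diff_act_sum_right single
    by (rule sum.swap)
  then show "diff_act f (diff_act h g) = diff_act (f * h) g"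
    unfolding poly_mapping_sum_single[symmetric] .
qed

definition inverse_system :: "('v::finite, 'k::field) mpoly set \<Rightarrow> ('v, 'k) mpoly set" where
  "inverse_system I = {g. \<forall>f\<in>I. diff_act f g = 0}"

text \<open>Monomials are normalised to have coefficient \<open>1\<close>, which removes the ambiguity of minimal
  generators up to nonzero scalars. \<open>module.span diff_act G\<close> is the \<open>R\<close>-submodule of \<open>S\<close>
  generated by \<open>G\<close> (see \<open>module_diff_act\<close>).\<close>

definition minimal_generators ::
    "('v::finite, 'k::field) mpoly set \<Rightarrow> ('v, 'k) mpoly set \<Rightarrow> bool" where
  "minimal_generators M G \<longleftrightarrow>
     G \<subseteq> {monomial b | b. True} \<and> module.span diff_act G = M \<and>
     (\<forall>H. H \<subset> G \<longrightarrow> module.span diff_act H \<noteq> M)"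

end

(* The residue classes of the monomials outside I form a basis of R/I; their exponents b are those
   with support in Delta and all b_i < a_i. In characteristic zero, differentiation sends y^b to a nonzero
   multiple of y^c whenever c <= b, so the inverse system is spanned by the monomials outside I,
   and both its minimal generators and the socle of R/I are given by the maximal ones among them.
   Since a_i >= 2, a maximal such b has a facet F as support and equals a_i - 1 on F. *)
theory Submission
  imports Defs
begin

section \<open>Monomials\<close>

text \<open>Everything ideal-theoretic is carried by one set \<open>N\<close> of exponent vectors,
  those of the monomials that the ideal omits. Membership in the ideal becomes a condition on
  \<open>keys\<close>, and the results on generators and socles are proved for such an
  \<open>N\<close> before any complex enters. Since \<open>minimal_generators\<close> has to hold
  for exactly one set, minimality alone is not the target: the maximal monomials are shown to form
  the least monomial generating set, from which existence and uniqueness both follow. The elements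
  of R/I are cosets, so its linear algebra has to go through representatives. Each class has one
  supported in \<open>N\<close>, and on those the conditions can be read off term by term. The
  socle-vector is a list that stops at the top degree of R/I, so the vanishing of the count beyond
  that degree needs its own argument.\<close>

lemma lookup_mult_monomial:
  "Poly_Mapping.lookup (f * monomial e) (b + e) = Poly_Mapping.lookup f b"
proof -
  have "f * monomial e =
      (\<Sum>c\<in>Poly_Mapping.keys f. Poly_Mapping.single (c + e) (Poly_Mapping.lookup f c))"
    using arg_cong[OF poly_mapping_sum_single[of f], of "\<lambda>g. g * monomial e"]
    by (simp only: sum_distrib_right monomial_def mult_single mult_1_right)
  then show ?thesis
    by (simp add: lookup_sum lookup_single when_def in_keys_iff)
qed

lemma keys_mult_monomial_subset:
  "Poly_Mapping.keys (f * monomial e) \<subseteq> (\<lambda>b. b + e) ` Poly_Mapping.keys f"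
  using keys_mult[of f "monomial e"] by (auto simp: monomial_def)

lemma keys_monomial [simp]: "Poly_Mapping.keys (monomial b :: ('v, 'k::field) mpoly) = {b}"
  by (simp add: monomial_def)

lemma single_one_neq_zero: "Poly_Mapping.single i (1::nat) \<noteq> 0"
  by (metis lookup_single_eq lookup_zero zero_neq_one)

lemma monomial_mult: "monomial b * monomial c = monomial (b + c)"
  by (simp add: monomial_def mult_single)

lemma monomial_zero: "monomial 0 = 1"
  by (simp add: monomial_def)

lemma monomial_sum: "monomial (\<Sum>i\<in>F. b i) = (\<Prod>i\<in>F. monomial (b i))"
  by (induction F rule: infinite_finite_induct) (simp_all add: monomial_zero monomial_mult[symmetric])

lemma var_power: "var i ^ n = monomial (Poly_Mapping.single i n)"
  by (induction n) (simp_all add: monomial_zero var_def monomial_mult single_add[symmetric])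

lemma single_eq_const_mult_monomial: "Poly_Mapping.single b c = const c * monomial b"
  by (simp add: const_def monomial_def mult_single)

lemma const_add: "const (c + d) = const c + const d"
  by (simp add: const_def single_add)

lemma const_mult: "const (c * d) = const c * const d"
  by (simp add: const_def mult_single)

lemma const_one: "const 1 = 1"
  by (simp add: const_def)

lemma const_uminus: "const (- c) = - const c"
  by (simp add: const_def single_uminus)

lemma const_eq_zero_iff: "const c = 0 \<longleftrightarrow> c = 0"
  by (metis const_def lookup_single_eq lookup_zero single_zero)


section \<open>Monomial ideals and their inverse systems\<close>

text \<open>Divisibility of monomials is expressed by a cofactor \<open>c\<close>, so no
  componentwise order on exponent vectors has to be introduced. \<open>maximal_exponents\<close>
  uses the same convention.\<close>

definition down_closed :: "('v \<Rightarrow>\<^sub>0 nat) set \<Rightarrow> bool" where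
  "down_closed N \<longleftrightarrow> (\<forall>b c. b + c \<in> N \<longrightarrow> b \<in> N)"

definition maximal_exponents :: "('v \<Rightarrow>\<^sub>0 nat) set \<Rightarrow> ('v \<Rightarrow>\<^sub>0 nat) set" where
  "maximal_exponents N = {b \<in> N. \<forall>c. b + c \<in> N \<longrightarrow> c = 0}"

text \<open>The k-span of the monomials with exponent outside \<open>N\<close>. The body makes sense
  for every \<open>N\<close>; down-closure is what turns it into an ideal.\<close>

definition complement_ideal :: "('v \<Rightarrow>\<^sub>0 nat) set \<Rightarrow> ('v, 'k::field) mpoly set" where
  "complement_ideal N = {f. Poly_Mapping.keys f \<inter> N = {}}"

lemma down_closedD:
  assumes "down_closed N" "b + c \<in> N"
  shows "b \<in> N" "c \<in> N"
  using assms by (auto simp: down_closed_def) (metis add.commute)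

section \<open>Ideals of the polynomial ring\<close>

lemma mpoly_ring_simps [simp]:
  "carrier mpoly_ring = UNIV" "mult mpoly_ring = (*)" "one mpoly_ring = 1"
  "zero mpoly_ring = 0" "add mpoly_ring = (+)"
  by (simp_all add: mpoly_ring_def)

text \<open>Negatives come for free from absorption, because -f = (-1) * f.\<close>

lemma ideal_mpoly_ringI:
  fixes I :: "('v, 'k::field) mpoly set"
  assumes "0 \<in> I" "\<And>f g. f \<in> I \<Longrightarrow> g \<in> I \<Longrightarrow> f + g \<in> I"
    and mult: "\<And>f g. g \<in> I \<Longrightarrow> f * g \<in> I"
  shows "ideal I mpoly_ring"
proof -
  interpret cring "mpoly_ring :: ('v, 'k) mpoly ring"
    by (rule cring_mpoly_ring)
  show ?thesis
  proof (rule idealI)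
    show "subgroup I (add_monoid mpoly_ring)"
    proof (rule add.subgroupI)
      fix f assume f: "f \<in> I"
      have "\<ominus>\<^bsub>mpoly_ring\<^esub> f = - f"
        by (rule minus_equality) simp_all
      then show "\<ominus>\<^bsub>mpoly_ring\<^esub> f \<in> I"
        using mult[OF f, of "- 1"] by simp
    qed (use assms in auto)
  qed (use assms in \<open>auto simp: ring_axioms mult.commute\<close>)
qed

text \<open>An exponent of f * g is a sum b + c with c an exponent of g. If it lay in
  \<open>N\<close>, down-closure would put c into \<open>N\<close> as well.\<close>

lemma ideal_complement_ideal:
  assumes "down_closed N"
  shows "ideal (complement_ideal N :: ('v, 'k::field) mpoly set) mpoly_ring"
proof (rule ideal_mpoly_ringI)
  show "0 \<in> (complement_ideal N :: ('v, 'k) mpoly set)"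
    by (simp add: complement_ideal_def)
next
  fix f g :: "('v, 'k) mpoly"
  assume "f \<in> complement_ideal N" "g \<in> complement_ideal N"
  then show "f + g \<in> complement_ideal N"
    using Poly_Mapping.keys_add[of f g] by (auto simp: complement_ideal_def)
next
  fix f g :: "('v, 'k) mpoly"
  assume g: "g \<in> complement_ideal N"
  have "b + c \<notin> N" if "c \<in> Poly_Mapping.keys g" for b c
    using down_closedD(2)[OF assms] g that by (auto simp: complement_ideal_def)
  then show "f * g \<in> complement_ideal N"
    using keys_mult[of f g] unfolding complement_ideal_def by blast
qed

lemma ideal_add_closed:
  assumes "ideal (I :: ('v, 'k::field) mpoly set) mpoly_ring" "f \<in> I" "g \<in> I"
  shows "f + g \<in> I"
proof -
  interpret ideal I mpoly_ring by fact
  show ?thesis using additive_subgroup.a_closed[OF additive_subgroup_axioms assms(2,3)] by simp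
qed

lemma ideal_mult_closed:
  assumes "ideal (I :: ('v, 'k::field) mpoly set) mpoly_ring" "g \<in> I"
  shows "f * g \<in> I"
proof -
  interpret ideal I mpoly_ring by fact
  show ?thesis using I_l_closed[OF assms(2), of f] by simp
qed

lemma ideal_zero_mem:
  assumes "ideal (I :: ('v, 'k::field) mpoly set) mpoly_ring"
  shows "0 \<in> I"
proof -
  interpret ideal I mpoly_ring by fact
  show ?thesis using additive_subgroup.zero_closed[OF additive_subgroup_axioms] by simp
qed

lemma ideal_sum_closed:
  assumes I: "ideal (I :: ('v, 'k::field) mpoly set) mpoly_ring" and "\<And>b. b \<in> B \<Longrightarrow> f b \<in> I"
  shows "sum f B \<in> I"
  using assms(2)
  by (induction B rule: infinite_finite_induct)
    (auto simp: ideal_zero_mem[OF I] intro: ideal_add_closed[OF I])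

text \<open>A polynomial is the sum of its terms, and each term is a ring multiple of its monomial,
  so an inclusion between ideals can be tested on monomials.\<close>

lemma complement_ideal_subset_iff:
  assumes I: "ideal (I :: ('v, 'k::field) mpoly set) mpoly_ring"
  shows "complement_ideal N \<subseteq> I \<longleftrightarrow> (\<forall>b. b \<notin> N \<longrightarrow> monomial b \<in> I)"
proof
  assume "complement_ideal N \<subseteq> I"
  then show "\<forall>b. b \<notin> N \<longrightarrow> monomial b \<in> I"
    by (auto simp: complement_ideal_def)
next
  assume N: "\<forall>b. b \<notin> N \<longrightarrow> monomial b \<in> I"
  show "complement_ideal N \<subseteq> I"
  proof
    fix f :: "('v, 'k) mpoly"
    assume "f \<in> complement_ideal N"
    then have "Poly_Mapping.single b (Poly_Mapping.lookup f b) \<in> I"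
      if "b \<in> Poly_Mapping.keys f" for b
      using that N unfolding single_eq_const_mult_monomial complement_ideal_def
      by (auto intro!: ideal_mult_closed[OF I])
    then show "f \<in> I"
      by (subst poly_mapping_sum_single) (rule ideal_sum_closed[OF I])
  qed
qed

section \<open>Supports under differentiation\<close>

text \<open>The two coefficients differ by a product of rising factorials of positive integers. This
  is the image of a positive integer, hence nonzero in characteristic zero.\<close>

lemma lookup_monomial_deriv_eq_zero_iff:
  fixes g :: "('v::finite, 'k::field_char_0) mpoly"
  shows "Poly_Mapping.lookup (monomial_deriv b g) c = 0 \<longleftrightarrow> Poly_Mapping.lookup g (c + b) = 0"
proof -
  have "pochhammer (of_nat (Suc m) :: 'k) n \<noteq> 0" for m n
    unfolding pochhammer_of_nat of_nat_eq_0_iff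
    by (metis pochhammer_pos less_irrefl zero_less_Suc)
  then show ?thesis
    unfolding lookup_monomial_deriv mult_eq_0_iff by simp
qed

lemma keys_monomial_deriv:
  fixes g :: "('v::finite, 'k::field_char_0) mpoly"
  shows "c \<in> Poly_Mapping.keys (monomial_deriv b g) \<longleftrightarrow> c + b \<in> Poly_Mapping.keys g"
  by (simp add: in_keys_iff lookup_monomial_deriv_eq_zero_iff)

text \<open>Only an inclusion can be expected: the contributions of different terms of f to the same
  exponent may cancel.\<close>

lemma keys_diff_act_subset:
  fixes g :: "('v::finite, 'k::field_char_0) mpoly"
  shows "Poly_Mapping.keys (diff_act f g) \<subseteq>
    {c. \<exists>b\<in>Poly_Mapping.keys f. c + b \<in> Poly_Mapping.keys g}"
proof
  fix c assume "c \<in> Poly_Mapping.keys (diff_act f g)"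
  then obtain b where "b \<in> Poly_Mapping.keys f"
      "c \<in> Poly_Mapping.keys (const (Poly_Mapping.lookup f b) * monomial_deriv b g)"
    unfolding diff_act_def using Poly_Mapping.keys_sum by fastforce
  then show "c \<in> {c. \<exists>b\<in>Poly_Mapping.keys f. c + b \<in> Poly_Mapping.keys g}"
    by (auto simp: in_keys_iff lookup_const_mult lookup_monomial_deriv_eq_zero_iff)
qed

lemma diff_act_monomial: "diff_act (monomial b) g = monomial_deriv b g"
  by (simp add: monomial_def diff_act_single const_one)

text \<open>If g had an exponent b outside \<open>N\<close>, then the monomial b would lie in the
  ideal, yet the derivative of g by b has nonzero constant term. Conversely, an exponent c of the
  action of f on g requires an exponent b of f with c + b in \<open>N\<close>, which forces b into
  \<open>N\<close>.\<close>

lemma inverse_system_complement_ideal: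
  assumes "down_closed N"
  shows "inverse_system (complement_ideal N) =
    {g :: ('v::finite, 'k::field_char_0) mpoly. Poly_Mapping.keys g \<subseteq> N}"
proof (intro equalityI subsetI CollectI)
  fix g :: "('v, 'k) mpoly" and b
  assume g: "g \<in> inverse_system (complement_ideal N)" and b: "b \<in> Poly_Mapping.keys g"
  show "b \<in> N"
  proof (rule ccontr)
    assume "b \<notin> N"
    then have "(monomial b :: ('v, 'k) mpoly) \<in> complement_ideal N"
      by (simp add: complement_ideal_def)
    then have "monomial_deriv b g = 0"
      using g by (auto simp: inverse_system_def diff_act_monomial[symmetric])
    moreover have "0 \<in> Poly_Mapping.keys (monomial_deriv b g)"
      using b by (simp add: keys_monomial_deriv)
    ultimately show False
      by simp
  qed
next
  fix g :: "('v, 'k) mpoly"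
  assume g: "g \<in> {g. Poly_Mapping.keys g \<subseteq> N}"
  have "Poly_Mapping.keys (diff_act f g) = {}" if "f \<in> complement_ideal N" for f
    using keys_diff_act_subset[of f g] that g down_closedD(2)[OF assms]
    unfolding complement_ideal_def by blast
  then show "g \<in> inverse_system (complement_ideal N)"
    by (simp add: inverse_system_def)
qed

text \<open>Divisors of divisors are divisors, so the right-hand side is a submodule. In the other
  direction, differentiating by the cofactor turns a generator into a nonzero multiple of any
  prescribed divisor.\<close>

lemma span_monomials:
  "module.span diff_act (monomial ` B) =
    {g :: ('v::finite, 'k::field_char_0) mpoly. Poly_Mapping.keys g \<subseteq> {c. \<exists>d. c + d \<in> B}}"
  (is "_ = ?D")
proof -
  interpret M: Modules.module "diff_act :: ('v, 'k) mpoly \<Rightarrow> _"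
    by (rule module_diff_act)
  show ?thesis
  proof (rule equalityI)
    have "M.subspace ?D"
    proof (rule M.subspaceI)
      fix x y :: "('v, 'k) mpoly"
      assume "x \<in> ?D" "y \<in> ?D"
      then show "x + y \<in> ?D"
        using Poly_Mapping.keys_add[of x y] by blast
    next
      fix f x :: "('v, 'k) mpoly"
      assume "x \<in> ?D"
      then show "diff_act f x \<in> ?D"
        using keys_diff_act_subset[of f x] by (auto 0 3 simp: subset_iff) (metis add.assoc)
    qed simp
    moreover have "monomial ` B \<subseteq> ?D"
      by (auto intro: exI[of _ 0])
    ultimately show "M.span (monomial ` B) \<subseteq> ?D"
      by (rule M.span_minimal[rotated])
  next
    show "?D \<subseteq> M.span (monomial ` B)"
    proof
      fix g assume g: "g \<in> ?D"
      have "Poly_Mapping.single c (Poly_Mapping.lookup g c) \<in> M.span (monomial ` B)"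
        if c: "c \<in> Poly_Mapping.keys g" for c
      proof -
        obtain d where d: "c + d \<in> B"
          using g c by auto
        \<comment> \<open>Its only exponent is c, and its coefficient there is nonzero, so the
          wanted term is a scalar multiple of h.\<close>
        define h :: "('v, 'k) mpoly" where "h = monomial_deriv d (monomial (c + d))"
        have h0: "Poly_Mapping.lookup h c \<noteq> 0"
          by (simp add: h_def lookup_monomial_deriv_eq_zero_iff monomial_def)
        have "Poly_Mapping.keys h \<subseteq> {c}"
          by (auto simp: h_def keys_monomial_deriv)
        then have h: "h = Poly_Mapping.single c (Poly_Mapping.lookup h c)"
          by (intro poly_mapping_eqI) (auto simp: lookup_single when_def in_keys_iff)
        have "Poly_Mapping.single c (Poly_Mapping.lookup g c) =
            const (Poly_Mapping.lookup g c / Poly_Mapping.lookup h c) * h"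
          by (subst (2) h) (simp add: const_def mult_single h0)
        \<comment> \<open>The span is closed under the action \<open>diff_act\<close>, so scaling by
          a field element has to be rewritten as the action of a constant polynomial.\<close>
        also have "\<dots> = diff_act (const (Poly_Mapping.lookup g c / Poly_Mapping.lookup h c)) h"
          by (simp add: const_def diff_act_single)
            (simp add: const_def[symmetric] diff_act_monomial[symmetric] monomial_zero)
        also have "h = diff_act (monomial d) (monomial (c + d))"
          by (simp add: h_def diff_act_monomial)
        finally show ?thesis
          using M.span_scale[OF M.span_scale[OF M.span_base[OF imageI[OF d]]]] by metis
      qed
      then show "g \<in> M.span (monomial ` B)"
        by (subst poly_mapping_sum_single) (rule M.span_sum)
    qed
  qed
qed

section \<open>Maximal exponents and minimal generators\<close>

text \<open>Among the multiples of b in \<open>N\<close>, one of largest total degree is maximal,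
  since a proper multiple has strictly larger degree.\<close>

lemma finite_exponents_below_maximal:
  fixes N :: "('v::finite \<Rightarrow>\<^sub>0 nat) set"
  assumes "finite N" "b \<in> N"
  shows "\<exists>d. b + d \<in> maximal_exponents N"
proof -
  define deg where "deg b = (\<Sum>i\<in>UNIV. Poly_Mapping.lookup b i)" for b :: "'v \<Rightarrow>\<^sub>0 nat"
  let ?A = "{c \<in> N. \<exists>d. c = b + d}"
  have "b \<in> ?A"
    using assms(2) by (auto intro: exI[of _ 0])
  then have "Max (deg ` ?A) \<in> deg ` ?A" and fin: "finite ?A"
    using assms(1) by (auto intro!: Max_in)
  then obtain c where c: "c \<in> N" "\<exists>d. c = b + d" and "deg c = Max (deg ` ?A)"
    by force
  then have max: "deg c' \<le> deg c" if "c' \<in> N" "\<exists>d. c' = b + d" for c'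
    using that fin by simp
  have "e = 0" if "c + e \<in> N" for e
  proof -
    have "deg (c + e) \<le> deg c"
      using c(2) that by (intro max) (auto simp: add.assoc)
    then have "deg e = 0"
      by (simp add: deg_def lookup_add sum.distrib)
    then show ?thesis
      by (intro poly_mapping_eqI) (simp add: deg_def)
  qed
  then show ?thesis
    using c by (auto simp: maximal_exponents_def)
qed

lemma keys_subset_eq_iff:
  "{g :: ('v, 'k::field) mpoly. Poly_Mapping.keys g \<subseteq> A} = {g. Poly_Mapping.keys g \<subseteq> B} \<longleftrightarrow> A = B"
proof
  assume eq: "{g :: ('v, 'k) mpoly. Poly_Mapping.keys g \<subseteq> A} = {g. Poly_Mapping.keys g \<subseteq> B}"
  have "b \<in> A \<longleftrightarrow> b \<in> B" for b
    using eq[unfolded set_eq_iff, rule_format, of "monomial b"] by simp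
  then show "A = B"
    by auto
qed simp

text \<open>Let \<open>B\<close> be the exponents of any monomial generating set. A maximal b
  divides some b + d in \<open>B\<close>, and \<open>B\<close> lies in \<open>N\<close>, so d = 0
  and b is in \<open>B\<close>. Thus every such set contains all maximal monomials. These generate
  because finiteness places each exponent below a maximal one.\<close>

lemma minimal_generators_iff:
  fixes N :: "('v::finite \<Rightarrow>\<^sub>0 nat) set" and G :: "('v, 'k::field_char_0) mpoly set"
  assumes "down_closed N" "finite N"
  shows "minimal_generators {g. Poly_Mapping.keys g \<subseteq> N} G \<longleftrightarrow>
    G = monomial ` maximal_exponents N"
proof -
  let ?M = "{g :: ('v, 'k) mpoly. Poly_Mapping.keys g \<subseteq> N}"
  have down: "{c. \<exists>d. c + d \<in> maximal_exponents N} = N"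
    using assms(1) finite_exponents_below_maximal[OF assms(2)]
    by (auto simp: down_closed_def maximal_exponents_def)
  have least: "maximal_exponents N \<subseteq> B" if B: "{c. \<exists>d. c + d \<in> B} = N" for B
  proof
    fix b assume b: "b \<in> maximal_exponents N"
    then obtain d where d: "b + d \<in> B"
      using B by (auto simp: maximal_exponents_def)
    then have "b + d \<in> N"
      using B by (auto intro: exI[of _ 0])
    then show "b \<in> B"
      using b d by (auto simp: maximal_exponents_def)
  qed
  have sub: "monomial ` maximal_exponents N \<subseteq> H"
    if "H \<subseteq> {monomial b | b. True}" "module.span diff_act H = ?M" for H :: "('v, 'k) mpoly set"
  proof -
    from that(1) obtain B where H: "H = monomial ` B"
      using subset_image_iff[of H monomial UNIV] by (auto simp: full_SetCompr_eq)
    have "{c. \<exists>d. c + d \<in> B} = N"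
      using that(2) unfolding H span_monomials keys_subset_eq_iff .
    then show ?thesis
      using least unfolding H by (intro image_mono)
  qed
  have span: "module.span diff_act (monomial ` maximal_exponents N :: ('v, 'k) mpoly set) = ?M"
    unfolding span_monomials down ..
  show ?thesis
    unfolding minimal_generators_def
  proof (intro iffI conjI allI impI)
    assume G: "G \<subseteq> {monomial b | b. True} \<and> module.span diff_act G = ?M \<and>
      (\<forall>H. H \<subset> G \<longrightarrow> module.span diff_act H \<noteq> ?M)"
    then show "G = monomial ` maximal_exponents N"
      using sub[of G] span by blast
  next
    fix H assume G: "G = monomial ` maximal_exponents N" and H: "H \<subset> G"
    then show "module.span diff_act H \<noteq> ?M"
      using sub[of H] by blast
  qed (use span in auto)
qed


section \<open>The socle of a monomial quotient\<close>

lemma mem_residue_class: "h \<in> residue_class I f \<longleftrightarrow> h - f \<in> I"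
  unfolding residue_class_def a_r_coset_def' by (auto intro: bexI[of _ "h - f"])

context
  fixes I :: "('v, 'k::field) mpoly set"
  assumes I: "ideal I mpoly_ring"
begin

lemma residue_class_eq_iff: "residue_class I f = residue_class I g \<longleftrightarrow> f - g \<in> I"
proof
  assume "residue_class I f = residue_class I g"
  then show "f - g \<in> I"
    using mem_residue_class[of f I f] mem_residue_class[of f I g] ideal_zero_mem[OF I] by simp
next
  assume *: "f - g \<in> I"
  then have "h - f \<in> I \<longleftrightarrow> h - g \<in> I" for h
    using ideal_add_closed[OF I, of "h - f" "f - g"]
      ideal_add_closed[OF I, of "h - g" "- 1 * (f - g)"] ideal_mult_closed[OF I *, of "- 1"]
    by auto
  then show "residue_class I f = residue_class I g"
    by (auto simp: mem_residue_class)
qed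

lemma ring_hom_residue_class: "ring_hom_ring mpoly_ring (quot_alg I) (residue_class I)"
  using ideal.rcos_ring_hom_ring[OF I]
  unfolding quot_alg_def residue_class_def[abs_def] .

lemma residue_class_mult:
  "residue_class I f \<otimes>\<^bsub>quot_alg I\<^esub> residue_class I g = residue_class I (f * g)"
  using ring_hom_mult[OF ring_hom_ring.homh[OF ring_hom_residue_class], of f g] by simp

lemma residue_class_add:
  "residue_class I f \<oplus>\<^bsub>quot_alg I\<^esub> residue_class I g = residue_class I (f + g)"
  using ring_hom_add[OF ring_hom_ring.homh[OF ring_hom_residue_class], of f g] by simp

lemma zero_quot_alg: "\<zero>\<^bsub>quot_alg I\<^esub> = residue_class I 0"
proof -
  interpret h: ring_hom_ring mpoly_ring "quot_alg I" "residue_class I"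
    by (rule ring_hom_residue_class)
  show ?thesis
    using h.hom_zero by simp
qed

lemma one_quot_alg: "\<one>\<^bsub>quot_alg I\<^esub> = residue_class I 1"
  using ring_hom_one[OF ring_hom_ring.homh[OF ring_hom_residue_class]] by simp

lemma carrier_quot_alg: "carrier (quot_alg I) = range (residue_class I)"
  by (auto simp: quot_alg_def FactRing_def A_RCOSETS_def' residue_class_def)

text \<open>The constants form a subfield of the polynomial ring, and the image of a subfield under
  a homomorphism to a nonzero ring is again one. The dimensions in the socle-vector are taken over
  this copy of k.\<close>

lemma subfield_scalars:
  assumes "1 \<notin> I"
  shows "subfield (scalars I) (quot_alg I)"
proof -
  interpret R: cring "mpoly_ring :: ('v, 'k) mpoly ring"
    by (rule cring_mpoly_ring)
  interpret h: ring_hom_ring mpoly_ring "quot_alg I" "residue_class I"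
    by (rule ring_hom_residue_class)
  have "subfield (range const) (mpoly_ring :: ('v, 'k) mpoly ring)"
  proof (rule R.subfieldI)
    have "subring (range const) (mpoly_ring :: ('v, 'k) mpoly ring)"
    proof (rule R.subringI)
      fix x :: "('v, 'k) mpoly" assume "x \<in> range const"
      moreover have "\<ominus>\<^bsub>mpoly_ring\<^esub> x = - x"
        by (rule R.minus_equality) simp_all
      ultimately show "\<ominus>\<^bsub>mpoly_ring\<^esub> x \<in> range const"
        by (auto simp: const_uminus[symmetric])
    qed (auto simp: const_one[symmetric] const_add[symmetric] const_mult[symmetric])
    then show "subcring (range const) (mpoly_ring :: ('v, 'k) mpoly ring)"
      by (rule R.subcringI')
    have "\<exists>y\<in>range const. y * const c = 1 \<and> const c * y = 1"
      if "c \<noteq> 0" for c :: 'k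
      using that
      by (intro bexI[of _ "const (inverse c)"])
        (simp_all add: const_one[symmetric] const_mult[symmetric])
    then show "Units (mpoly_ring\<lparr>carrier := range const\<rparr>) =
        range const - {\<zero>\<^bsub>mpoly_ring :: ('v, 'k) mpoly ring\<^esub>}"
      by (auto simp: Units_def const_eq_zero_iff)
  qed
  moreover have "\<one>\<^bsub>quot_alg I\<^esub> \<noteq> \<zero>\<^bsub>quot_alg I\<^esub>"
    using assms by (simp add: one_quot_alg zero_quot_alg residue_class_eq_iff)
  moreover have "scalars I = residue_class I ` range const"
    by (auto simp: scalars_def)
  ultimately show ?thesis
    using h.img_is_subfield(2) by simp
qed

end

section \<open>Representatives supported in \<open>N\<close> and dimensions\<close>

text \<open>The terms with exponent outside \<open>N\<close> add up to an element of the ideal and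
  can be discarded.\<close>

lemma residue_class_restrict:
  assumes "down_closed N"
  shows "\<exists>g. residue_class (complement_ideal N) g = residue_class (complement_ideal N) f \<and>
    Poly_Mapping.keys g = Poly_Mapping.keys f \<inter> N"
proof -
  define g where "g = (\<Sum>b\<in>Poly_Mapping.keys f \<inter> N. Poly_Mapping.single b (Poly_Mapping.lookup f b))"
  have lookup: "Poly_Mapping.lookup g b = (if b \<in> N then Poly_Mapping.lookup f b else 0)" for b
    by (simp add: g_def lookup_sum lookup_single when_def in_keys_iff)
  then have "g - f \<in> complement_ideal N"
    by (auto simp: complement_ideal_def in_keys_iff lookup_minus)
  moreover have "Poly_Mapping.keys g = Poly_Mapping.keys f \<inter> N"
    by (auto simp: in_keys_iff lookup split: if_splits)
  ultimately show ?thesis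
    using residue_class_eq_iff[OF ideal_complement_ideal[OF assms]] by blast
qed

text \<open>The monomials in \<open>N\<close> are linearly independent modulo the ideal, since no
  element of the ideal has an exponent in \<open>N\<close>. The induction follows the inductive
  definition of \<open>dimension\<close>: one monomial outside the space built so far is adjoined at
  a time.\<close>

lemma dimension_residue_classes:
  fixes N :: "('v::finite \<Rightarrow>\<^sub>0 nat) set"
  defines "I \<equiv> complement_ideal N :: ('v, 'k::field) mpoly set"
  assumes N: "down_closed N" and "finite B" "B \<subseteq> N"
  shows "ring.dimension (quot_alg I) (card B) (scalars I)
    {residue_class I f | f. Poly_Mapping.keys f \<subseteq> B}"
proof -
  have I: "ideal I mpoly_ring"
    unfolding I_def by (rule ideal_complement_ideal[OF N])
  interpret h: ring_hom_ring mpoly_ring "quot_alg I" "residue_class I"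
    by (rule ring_hom_residue_class[OF I])
  show ?thesis
    using assms(3,4)
  proof (induction B rule: finite_induct)
    case empty
    have "{residue_class I f | f. Poly_Mapping.keys f \<subseteq> {}} = {\<zero>\<^bsub>quot_alg I\<^esub>}"
      by (auto simp: zero_quot_alg[OF I])
    then show ?case
      using h.S.dimension.zero_dim by simp
  next
    case (insert b B)
    let ?E = "{residue_class I f | f. Poly_Mapping.keys f \<subseteq> B}"
    let ?v = "residue_class I (monomial b)"
    have "h.S.dimension (Suc (card B)) (scalars I) (h.S.line_extension (scalars I) ?v ?E)"
    proof (rule h.S.dimension.Suc_dim)
      show "?v \<in> carrier (quot_alg I)"
        by (simp add: carrier_quot_alg[OF I])
      show "?v \<notin> ?E"
      proof
        assume "?v \<in> ?E"
        then obtain f where "monomial b - f \<in> I" and f: "Poly_Mapping.keys f \<subseteq> B"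
          by (auto simp: residue_class_eq_iff[OF I])
        then have "b \<notin> Poly_Mapping.keys (monomial b - f)"
          using insert.prems by (auto simp: I_def complement_ideal_def)
        moreover have "Poly_Mapping.lookup f b = 0"
          using f insert.hyps by (metis in_keys_iff subsetD)
        ultimately show False
          by (simp add: in_keys_iff lookup_minus monomial_def)
      qed
      show "h.S.dimension (card B) (scalars I) ?E"
        using insert by simp
    qed
    moreover have "h.S.line_extension (scalars I) ?v ?E =
        {residue_class I f | f. Poly_Mapping.keys f \<subseteq> insert b B}" (is "?L = ?R")
    proof (intro equalityI subsetI)
      fix p assume "p \<in> ?L"
      then obtain c f where p: "p = residue_class I (const c * monomial b + f)"
          and f: "Poly_Mapping.keys f \<subseteq> B"
        by (auto simp: h.S.line_extension_def r_coset_def set_add_def' scalars_def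
            residue_class_mult[OF I] residue_class_add[OF I])
      have "Poly_Mapping.keys (const c * monomial b + f) \<subseteq> insert b B"
        using f Poly_Mapping.keys_add[of "const c * monomial b" f]
        by (auto simp: single_eq_const_mult_monomial[symmetric] split: if_splits)
      then show "p \<in> ?R"
        using p by auto
    next
      fix p assume "p \<in> ?R"
      then obtain f where p: "p = residue_class I f" and f: "Poly_Mapping.keys f \<subseteq> insert b B"
        by auto
      \<comment> \<open>Removing the b-term splits f into a multiple of the new basis vector and a
        polynomial supported in the old set.\<close>
      define g where "g = f - Poly_Mapping.single b (Poly_Mapping.lookup f b)"
      have "Poly_Mapping.keys g \<subseteq> B"
        using f by (auto simp: g_def in_keys_iff lookup_minus lookup_single when_def split: if_splits)
      moreover have "f = const (Poly_Mapping.lookup f b) * monomial b + g"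
        by (simp add: g_def single_eq_const_mult_monomial)
      then have "p = residue_class I (const (Poly_Mapping.lookup f b)) \<otimes>\<^bsub>quot_alg I\<^esub> ?v
          \<oplus>\<^bsub>quot_alg I\<^esub> residue_class I g"
        by (simp add: p residue_class_mult[OF I] residue_class_add[OF I])
      ultimately show "p \<in> ?L"
        by (auto simp: h.S.line_extension_def r_coset_def set_add_def' scalars_def)
    qed
    ultimately show ?case
      using insert.hyps by simp
  qed
qed

section \<open>Socle, grading and socle-vector\<close>

text \<open>Multiplication by a variable shifts exponents injectively, so nothing cancels and
  annihilation modulo the ideal is decided separately for each term. A term with exponent in
  \<open>N\<close> is annihilated by all variables exactly when its exponent is maximal.\<close>

lemma socle_graded_part:
  fixes N :: "('v::finite \<Rightarrow>\<^sub>0 nat) set"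
  defines "I \<equiv> complement_ideal N :: ('v, 'k::field) mpoly set"
  assumes N: "down_closed N"
  shows "socle I \<inter> graded_part I j = {residue_class I f | f. Poly_Mapping.keys f \<subseteq>
    {b \<in> maximal_exponents N. (\<Sum>i\<in>UNIV. Poly_Mapping.lookup b i) = j}}"
    (is "?L = ?R")
proof -
  have I: "ideal I mpoly_ring"
    unfolding I_def by (rule ideal_complement_ideal[OF N])
  have socle: "residue_class I f \<in> socle I \<longleftrightarrow> (\<forall>i. f * var i \<in> I)" for f
    by (auto simp: socle_def carrier_quot_alg[OF I] residue_class_mult[OF I]
        zero_quot_alg[OF I] residue_class_eq_iff[OF I])
  show ?thesis
  proof (intro equalityI subsetI)
    fix p assume p: "p \<in> ?L"
    then obtain f where f: "p = residue_class I f" "homogeneous j f"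
      by (auto simp: graded_part_def)
    \<comment> \<open>The terms of f outside \<open>N\<close> are unconstrained by the socle
      condition. Discarding them keeps both the class and the homogeneity.\<close>
    obtain g where g: "residue_class I g = residue_class I f"
        "Poly_Mapping.keys g = Poly_Mapping.keys f \<inter> N"
      using residue_class_restrict[OF N] unfolding I_def by blast
    have "b \<in> maximal_exponents N" if b: "b \<in> Poly_Mapping.keys g" for b
    proof -
      have "c = 0" if c: "b + c \<in> N" for c
      proof (rule ccontr)
        assume "c \<noteq> 0"
        then obtain i where i: "Poly_Mapping.lookup c i \<noteq> 0"
          by (metis lookup_zero poly_mapping_eqI)
        let ?e = "Poly_Mapping.single i (1::nat)"
        \<comment> \<open>Subtraction is truncated, but c has a positive entry at i. Hence b + c is
          a multiple of b + \<open>?e\<close>, and down-closure reduces non-maximality to a single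
          variable.\<close>
        have "c = ?e + (c - ?e)"
          using i by (intro poly_mapping_eqI) (auto simp: lookup_add lookup_minus lookup_single when_def)
        then have "b + ?e \<in> N"
          using N c unfolding down_closed_def by (metis add.assoc)
        moreover have "g * var i \<in> I"
          using p f g socle by (metis IntD1)
        ultimately have "Poly_Mapping.lookup (g * var i) (b + ?e) = 0"
          by (auto simp: I_def complement_ideal_def in_keys_iff)
        then show False
          using b by (simp add: var_def lookup_mult_monomial in_keys_iff del: One_nat_def)
      qed
      then show ?thesis
        using b g by (auto simp: maximal_exponents_def)
    qed
    then have "Poly_Mapping.keys g \<subseteq>
        {b \<in> maximal_exponents N. (\<Sum>i\<in>UNIV. Poly_Mapping.lookup b i) = j}"
      using f(2) g(2) by (auto simp: homogeneous_def)
    then show "p \<in> ?R"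
      using f(1) g(1) by blast
  next
    fix p assume "p \<in> ?R"
    then obtain f where p: "p = residue_class I f"
        and f: "Poly_Mapping.keys f \<subseteq> {b \<in> maximal_exponents N. (\<Sum>i\<in>UNIV. Poly_Mapping.lookup b i) = j}"
      by auto
    have "f * var i \<in> I" for i
    proof -
      have "b + Poly_Mapping.single i 1 \<notin> N" if "b \<in> Poly_Mapping.keys f" for b
      proof
        assume "b + Poly_Mapping.single i 1 \<in> N"
        then have "Poly_Mapping.single i (1::nat) = 0"
          using f that by (auto simp: maximal_exponents_def)
        then show False
          by (simp only: single_one_neq_zero)
      qed
      then show ?thesis
        using keys_mult_monomial_subset[of f "Poly_Mapping.single i 1"]
        by (auto simp: I_def complement_ideal_def var_def)
    qed
    moreover have "homogeneous j f"
      using f by (auto simp: homogeneous_def)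
    ultimately show "p \<in> ?L"
      using p socle by (auto simp: graded_part_def)
  qed
qed

lemma graded_part_eq_zero_iff:
  fixes N :: "('v::finite \<Rightarrow>\<^sub>0 nat) set"
  defines "I \<equiv> complement_ideal N :: ('v, 'k::field) mpoly set"
  assumes N: "down_closed N"
  shows "graded_part I j = {\<zero>\<^bsub>quot_alg I\<^esub>} \<longleftrightarrow>
    (\<forall>b\<in>N. (\<Sum>i\<in>UNIV. Poly_Mapping.lookup b i) \<noteq> j)"
proof -
  have I: "ideal I mpoly_ring"
    unfolding I_def by (rule ideal_complement_ideal[OF N])
  \<comment> \<open>Zero is homogeneous of every degree, so a graded part always contains the zero
    class, and it equals the zero space as soon as it contains nothing else.\<close>
  have "homogeneous j (0 :: ('v, 'k) mpoly)"
    by (simp add: homogeneous_def)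
  then have "graded_part I j = {\<zero>\<^bsub>quot_alg I\<^esub>} \<longleftrightarrow>
      (\<forall>f. homogeneous j f \<longrightarrow> residue_class I f = residue_class I 0)"
    unfolding graded_part_def zero_quot_alg[OF I] by blast
  also have "\<dots> \<longleftrightarrow> (\<forall>f. homogeneous j f \<longrightarrow> f \<in> I)"
    by (simp add: residue_class_eq_iff[OF I])
  also have "\<dots> \<longleftrightarrow> (\<forall>b\<in>N. (\<Sum>i\<in>UNIV. Poly_Mapping.lookup b i) \<noteq> j)"
  proof
    assume *: "\<forall>f :: ('v, 'k) mpoly. homogeneous j f \<longrightarrow> f \<in> I"
    show "\<forall>b\<in>N. (\<Sum>i\<in>UNIV. Poly_Mapping.lookup b i) \<noteq> j"
    proof
      fix b assume "b \<in> N"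
      then show "(\<Sum>i\<in>UNIV. Poly_Mapping.lookup b i) \<noteq> j"
        using *[rule_format, of "monomial b"]
        by (auto simp: homogeneous_def I_def complement_ideal_def)
    qed
  qed (auto simp: homogeneous_def I_def complement_ideal_def)
  finally show ?thesis .
qed

text \<open>That 0 lies in \<open>N\<close> means that 1 is not in the ideal, so the quotient is
  nonzero and its scalars form a field.\<close>

lemma nth_socle_vector:
  fixes N :: "('v::finite \<Rightarrow>\<^sub>0 nat) set"
  assumes N: "down_closed N" "finite N" "0 \<in> N"
  shows "nth_default 0 (socle_vector (complement_ideal N :: ('v, 'k::field) mpoly set)) j =
    card {b \<in> maximal_exponents N. (\<Sum>i\<in>UNIV. Poly_Mapping.lookup b i) = j}"
proof -
  let ?I = "complement_ideal N :: ('v, 'k) mpoly set"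
  let ?deg = "\<lambda>b :: 'v \<Rightarrow>\<^sub>0 nat. \<Sum>i\<in>UNIV. Poly_Mapping.lookup b i"
  let ?B = "\<lambda>j. {b \<in> maximal_exponents N. ?deg b = j}"
  have I: "ideal ?I mpoly_ring"
    by (rule ideal_complement_ideal[OF N(1)])
  interpret Q: ring "quot_alg ?I"
    by (rule ring_hom_ring.axioms(2)[OF ring_hom_residue_class[OF I]])
  have "(1 :: ('v, 'k) mpoly) \<notin> ?I"
    using N(3) by (simp add: complement_ideal_def)
  then have K: "subfield (scalars ?I) (quot_alg ?I)"
    by (rule subfield_scalars[OF I])
  have dim: "Q.dim (scalars ?I) (socle ?I \<inter> graded_part ?I j) = card (?B j)" for j
  proof -
    have "?B j \<subseteq> N"
      by (auto simp: maximal_exponents_def)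
    then have "Q.dimension (card (?B j)) (scalars ?I) (socle ?I \<inter> graded_part ?I j)"
      unfolding socle_graded_part[OF N(1)] using finite_subset[OF _ N(2)]
      by (intro dimension_residue_classes[OF N(1)]) auto
    then show ?thesis
      using Q.dimI[OF K] by (simp add: over_def)
  qed
  show ?thesis
  proof (cases "j \<le> top_degree ?I")
    case True
    then show ?thesis
      by (simp add: socle_vector_def nth_default_def dim del: upt_Suc)
  next
    \<comment> \<open>Beyond the end of the list the default 0 is read, so the count must vanish
      there too: no exponent in \<open>N\<close> exceeds the top degree.\<close>
    case False
    have "?deg b \<le> top_degree ?I" if b: "b \<in> N" for b
    proof -
      \<comment> \<open>\<open>GREATEST\<close> gives an upper bound only for a bounded set of
        degrees; finiteness of \<open>N\<close> supplies the bound.\<close>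
      have "?deg c \<le> Max (?deg ` N)" if "c \<in> N" for c
        using that N(2) by simp
      then show ?thesis
        unfolding top_degree_def using b
        by (intro Greatest_le_nat[of _ _ "Max (?deg ` N)"])
          (auto simp: graded_part_eq_zero_iff[OF N(1)])
    qed
    then have "?B j = {}"
      using False by (auto simp: maximal_exponents_def)
    then have "card (?B j) = 0"
      by (simp only: card.empty)
    then show ?thesis
      using False by (simp add: socle_vector_def nth_default_def del: upt_Suc)
  qed
qed


section \<open>Stanley-Reisner ideals with powers of the variables\<close>

definition standard_exponents :: "'v set set \<Rightarrow> ('v \<Rightarrow> nat) \<Rightarrow> ('v \<Rightarrow>\<^sub>0 nat) set" where
  "standard_exponents \<Delta> a = {b. Poly_Mapping.keys b \<in> \<Delta> \<and> (\<forall>i. Poly_Mapping.lookup b i < a i)}"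

lemma keys_plus_nat:
  "Poly_Mapping.keys (b + c :: 'v \<Rightarrow>\<^sub>0 nat) = Poly_Mapping.keys b \<union> Poly_Mapping.keys c"
  by (auto simp: in_keys_iff lookup_add)

lemma down_closed_standard_exponents:
  assumes "simplicial_complex \<Delta>"
  shows "down_closed (standard_exponents \<Delta> a)"
  unfolding down_closed_def
proof (intro allI impI)
  fix b c assume bc: "b + c \<in> standard_exponents \<Delta> a"
  then have "Poly_Mapping.keys b \<in> \<Delta>"
    using assms by (auto simp: standard_exponents_def keys_plus_nat simplicial_complex_def)
  moreover have "Poly_Mapping.lookup b i < a i" for i
    using bc by (auto simp: standard_exponents_def lookup_add dest!: spec[of _ i])
  ultimately show "b \<in> standard_exponents \<Delta> a"
    by (simp add: standard_exponents_def)
qed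

lemma finite_standard_exponents:
  "finite (standard_exponents \<Delta> a :: ('v::finite \<Rightarrow>\<^sub>0 nat) set)"
proof (rule finite_imageD)
  have "finite (PiE UNIV (\<lambda>i. {..<a i}))"
    by (rule finite_PiE) simp_all
  then show "finite (Poly_Mapping.lookup ` (standard_exponents \<Delta> a :: ('v \<Rightarrow>\<^sub>0 nat) set))"
    by (rule rev_finite_subset) (auto simp: standard_exponents_def)
  show "inj_on Poly_Mapping.lookup (standard_exponents \<Delta> a)"
    by (rule inj_onI) (simp add: lookup_inject)
qed

lemma exponent_diff_add:
  fixes b c :: "'v \<Rightarrow>\<^sub>0 nat"
  assumes "\<And>i. Poly_Mapping.lookup c i \<le> Poly_Mapping.lookup b i"
  shows "(b - c) + c = b"
  using assms by (intro poly_mapping_eqI) (simp add: lookup_add lookup_minus)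

text \<open>One inclusion is checked on generators. For the other, a monomial outside
  \<open>standard_exponents\<close> is divisible by a generator: by a pure power if some exponent is
  too large, by the squarefree monomial of its support if that support is not a face.\<close>

lemma defining_ideal_eq:
  assumes \<Delta>: "simplicial_complex \<Delta>"
  shows "defining_ideal \<Delta> a =
    (complement_ideal (standard_exponents \<Delta> a) :: ('v::finite, 'k::field) mpoly set)"
proof -
  interpret R: cring "mpoly_ring :: ('v, 'k) mpoly ring"
    by (rule cring_mpoly_ring)
  let ?C = "complement_ideal (standard_exponents \<Delta> a) :: ('v, 'k) mpoly set"
  let ?S = "{\<Prod>i\<in>F. var i | F. F \<notin> \<Delta>} :: ('v, 'k) mpoly set"
  let ?P = "{var i ^ a i | i. True} :: ('v, 'k) mpoly set"
  have C: "ideal ?C mpoly_ring"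
    by (rule ideal_complement_ideal[OF down_closed_standard_exponents[OF \<Delta>]])
  have S: "ideal (stanley_reisner_ideal \<Delta> :: ('v, 'k) mpoly set) mpoly_ring"
    unfolding stanley_reisner_ideal_def by (rule R.genideal_ideal) simp
  have P: "ideal (power_ideal a :: ('v, 'k) mpoly set) mpoly_ring"
    unfolding power_ideal_def by (rule R.genideal_ideal) simp
  \<comment> \<open>As the ideal generated by a union, the sum inherits both an ideal property and a
    minimality property.\<close>
  have union: "defining_ideal \<Delta> a =
      Idl\<^bsub>mpoly_ring\<^esub> (stanley_reisner_ideal \<Delta> \<union> power_ideal a :: ('v, 'k) mpoly set)"
    unfolding defining_ideal_def by (rule R.union_genideal[OF S P, symmetric])
  have D: "ideal (defining_ideal \<Delta> a :: ('v, 'k) mpoly set) mpoly_ring"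
    unfolding union by (rule R.genideal_ideal) simp
  have squarefree: "(\<Prod>i\<in>F. var i) = (monomial (\<Sum>i\<in>F. Poly_Mapping.single i 1) :: ('v, 'k) mpoly)" for F
    by (simp add: monomial_sum var_def)
  have lookup_squarefree: "Poly_Mapping.lookup (\<Sum>i\<in>F. Poly_Mapping.single i (1::nat)) j = (if j \<in> F then 1 else 0)"
    for F :: "'v set" and j
    by (simp add: lookup_sum lookup_single when_def)
  have "?S \<subseteq> ?C"
  proof -
    have "Poly_Mapping.keys (\<Sum>i\<in>F. Poly_Mapping.single i (1::nat)) = F" for F :: "'v set"
      by (auto simp: in_keys_iff lookup_squarefree simp del: One_nat_def split: if_splits)
    then show ?thesis
      by (auto simp: squarefree complement_ideal_def standard_exponents_def)
  qed
  then have "stanley_reisner_ideal \<Delta> \<subseteq> ?C"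
    unfolding stanley_reisner_ideal_def by (rule R.genideal_minimal[OF C])
  moreover have "?P \<subseteq> ?C"
  proof -
    have "Poly_Mapping.single i (a i) \<notin> standard_exponents \<Delta> a" for i
      by (auto simp: standard_exponents_def intro!: exI[of _ i])
    then show ?thesis
      by (auto simp: var_power complement_ideal_def)
  qed
  then have "power_ideal a \<subseteq> ?C"
    unfolding power_ideal_def by (rule R.genideal_minimal[OF C])
  ultimately have "defining_ideal \<Delta> a \<subseteq> ?C"
    unfolding union by (intro R.genideal_minimal[OF C]) simp
  moreover have "monomial b \<in> (defining_ideal \<Delta> a :: ('v, 'k) mpoly set)"
    if b: "b \<notin> standard_exponents \<Delta> a" for b
  proof -
    have gens: "?S \<subseteq> defining_ideal \<Delta> a" "?P \<subseteq> defining_ideal \<Delta> a"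
      using R.genideal_self[of ?S] R.genideal_self[of ?P]
        R.genideal_self[of "stanley_reisner_ideal \<Delta> \<union> power_ideal a"]
      unfolding union stanley_reisner_ideal_def power_ideal_def by auto
    have "\<exists>c. monomial c \<in> (defining_ideal \<Delta> a :: ('v, 'k) mpoly set) \<and>
        (\<forall>i. Poly_Mapping.lookup c i \<le> Poly_Mapping.lookup b i)"
    proof (cases "Poly_Mapping.keys b \<in> \<Delta>")
      case True
      then obtain i where "a i \<le> Poly_Mapping.lookup b i"
        using b by (auto simp: standard_exponents_def not_less)
      then show ?thesis
        using gens(2) by (intro exI[of _ "Poly_Mapping.single i (a i)"])
          (auto simp: var_power[symmetric] lookup_single when_def)
    next
      case False
      then have "(\<Prod>i\<in>Poly_Mapping.keys b. var i) \<in> (defining_ideal \<Delta> a :: ('v, 'k) mpoly set)"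
        using gens(1) by blast
      then show ?thesis
        by (intro exI[of _ "\<Sum>i\<in>Poly_Mapping.keys b. Poly_Mapping.single i 1"])
          (auto simp: squarefree lookup_squarefree in_keys_iff Suc_le_eq simp del: One_nat_def)
    qed
    then obtain c where c: "monomial c \<in> (defining_ideal \<Delta> a :: ('v, 'k) mpoly set)"
        and "\<And>i. Poly_Mapping.lookup c i \<le> Poly_Mapping.lookup b i"
      by blast
    then have "monomial b = monomial (b - c) * (monomial c :: ('v, 'k) mpoly)"
      unfolding monomial_mult using exponent_diff_add[of c b] by simp
    then show ?thesis
      using ideal_mult_closed[OF D c] by simp
  qed
  then have "?C \<subseteq> defining_ideal \<Delta> a"
    by (simp add: complement_ideal_subset_iff[OF D])
  ultimately show ?thesis
    by (rule equalityI)
qed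

definition facet_exponent :: "('v::finite \<Rightarrow> nat) \<Rightarrow> 'v set \<Rightarrow> 'v \<Rightarrow>\<^sub>0 nat" where
  "facet_exponent a F = (\<Sum>i\<in>F. Poly_Mapping.single i (a i - 1))"

lemma lookup_facet_exponent:
  "Poly_Mapping.lookup (facet_exponent a F) i = (if i \<in> F then a i - 1 else 0)"
  by (simp add: facet_exponent_def lookup_sum lookup_single when_def)

lemma monomial_facet_exponent: "monomial (facet_exponent a F) = (\<Prod>i\<in>F. var i ^ (a i - 1))"
  by (simp add: facet_exponent_def monomial_sum var_power)

text \<open>As a_i >= 2, all entries a_i - 1 on \<open>F\<close> are positive, so the exponent
  vector determines \<open>F\<close>.\<close>

lemma keys_facet_exponent:
  assumes "\<forall>i. a i \<ge> 2"
  shows "Poly_Mapping.keys (facet_exponent a F) = F"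
proof -
  have "a i - 1 \<noteq> 0" for i
    using assms[rule_format, of i] by simp
  then show ?thesis
    by (auto simp: in_keys_iff lookup_facet_exponent simp del: One_nat_def split: if_splits)
qed

lemma maximal_standard_exponents:
  assumes \<Delta>: "simplicial_complex \<Delta>" and a: "\<forall>i. a i \<ge> 2"
  shows "maximal_exponents (standard_exponents \<Delta> a) = facet_exponent a ` facets \<Delta>"
proof (intro equalityI subsetI)
  fix b assume "b \<in> maximal_exponents (standard_exponents \<Delta> a)"
  then have b: "Poly_Mapping.keys b \<in> \<Delta>" "\<And>i. Poly_Mapping.lookup b i < a i"
      and max: "\<And>c. b + c \<in> standard_exponents \<Delta> a \<Longrightarrow> c = 0"
    by (auto simp: maximal_exponents_def standard_exponents_def)
  \<comment> \<open>This serves twice. For i in the support it fixes the value a_i - 1. For i in a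
    face containing the support it makes the exponent positive, so i was already in the support,
    which is therefore a facet.\<close>
  have not_raise: "Suc (Poly_Mapping.lookup b i) = a i"
    if "insert i (Poly_Mapping.keys b) \<in> \<Delta>" for i
  proof (rule ccontr)
    assume "Suc (Poly_Mapping.lookup b i) \<noteq> a i"
    then have "b + Poly_Mapping.single i 1 \<in> standard_exponents \<Delta> a"
      using that b(2) Suc_lessI[OF b(2)[of i]]
      by (auto simp: standard_exponents_def keys_plus_nat lookup_add lookup_single when_def)
    then show False
      using max[of "Poly_Mapping.single i 1"] by (simp add: single_one_neq_zero del: One_nat_def)
  qed
  have "G = Poly_Mapping.keys b" if G: "G \<in> \<Delta>" "Poly_Mapping.keys b \<subseteq> G" for G
  proof (intro equalityI subsetI)
    fix i assume i: "i \<in> G"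
    then have "Suc (Poly_Mapping.lookup b i) = a i"
      using \<Delta> G by (intro not_raise) (auto simp: simplicial_complex_def)
    then show "i \<in> Poly_Mapping.keys b"
      using a[rule_format, of i] by (auto simp: in_keys_iff)
  qed (use G in auto)
  then have "Poly_Mapping.keys b \<in> facets \<Delta>"
    using b(1) by (simp add: facets_def)
  moreover have "b = facet_exponent a (Poly_Mapping.keys b)"
  proof (rule poly_mapping_eqI)
    fix i
    show "Poly_Mapping.lookup b i = Poly_Mapping.lookup (facet_exponent a (Poly_Mapping.keys b)) i"
      using not_raise[of i] b(1)
      by (auto simp: lookup_facet_exponent insert_absorb in_keys_iff)
  qed
  ultimately show "b \<in> facet_exponent a ` facets \<Delta>"
    by blast
next
  fix b assume "b \<in> facet_exponent a ` facets \<Delta>"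
  then obtain F where b: "b = facet_exponent a F" and F: "F \<in> facets \<Delta>"
    by blast
  have pos: "a i - 1 < a i" "0 < a i" for i
    using a[rule_format, of i] by simp_all
  have "c = 0" if c: "b + c \<in> standard_exponents \<Delta> a" for c
  proof (rule poly_mapping_eqI)
    fix i
    \<comment> \<open>A facet cannot grow, so c is supported on \<open>F\<close>; there b already
      has the largest entries allowed.\<close>
    have "F \<union> Poly_Mapping.keys c \<in> \<Delta>"
      using c by (simp add: standard_exponents_def keys_plus_nat b keys_facet_exponent[OF a])
    then have "Poly_Mapping.keys c \<subseteq> F"
      using F by (auto simp: facets_def)
    moreover have "Poly_Mapping.lookup b i + Poly_Mapping.lookup c i < a i"
      using c by (simp add: standard_exponents_def lookup_add)
    ultimately show "Poly_Mapping.lookup c i = Poly_Mapping.lookup 0 i"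
      by (cases "i \<in> F") (auto simp: b lookup_facet_exponent in_keys_iff)
  qed
  moreover have "b \<in> standard_exponents \<Delta> a"
    using F pos
    by (auto simp: b standard_exponents_def keys_facet_exponent[OF a] lookup_facet_exponent facets_def)
  ultimately show "b \<in> maximal_exponents (standard_exponents \<Delta> a)"
    by (simp add: maximal_exponents_def)
qed

theorem theorem3p2:
  fixes \<Delta> :: "'v::finite set set"
    and a :: "'v \<Rightarrow> nat"
    and I :: "('v, 'k::field_char_0) mpoly set"
  assumes "simplicial_complex \<Delta>"
    and "\<forall>F\<in>facets \<Delta>. card F \<noteq> 1"
    and "\<forall>i. a i \<ge> 2"
    and "I = defining_ideal \<Delta> a"
  shows "(\<forall>G. minimal_generators (inverse_system I) G \<longleftrightarrow>
             G = {\<Prod>i\<in>F. var i ^ (a i - 1) | F. F \<in> facets \<Delta>}) \<and>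
         (\<forall>j. nth_default 0 (socle_vector I) j =
             card {F \<in> facets \<Delta>. (\<Sum>i\<in>F. a i - 1) = j})"
proof -
  let ?N = "standard_exponents \<Delta> a"
  note down = down_closed_standard_exponents[OF assms(1), of a]
  note maximal = maximal_standard_exponents[OF assms(1,3)]
  have I: "I = complement_ideal ?N"
    using assms(4) defining_ideal_eq[OF assms(1)] by simp
  have generators: "monomial ` maximal_exponents ?N =
      ({\<Prod>i\<in>F. var i ^ (a i - 1) | F. F \<in> facets \<Delta>} :: ('v, 'k) mpoly set)"
    unfolding maximal image_image monomial_facet_exponent by blast
  \<comment> \<open>The empty face lies below a vertex; it is the support of the exponent 0, that
    is, of the monomial 1.\<close>
  have "{} \<in> \<Delta>"
    using assms(1) by (auto simp: simplicial_complex_def)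
  moreover have "0 < a i" for i
    using assms(3)[rule_format, of i] by simp
  ultimately have "0 \<in> ?N"
    by (simp add: standard_exponents_def)
  then have "nth_default 0 (socle_vector I) j =
      card {b \<in> maximal_exponents ?N. (\<Sum>i\<in>UNIV. Poly_Mapping.lookup b i) = j}" for j
    unfolding I by (rule nth_socle_vector[OF down finite_standard_exponents])
  moreover have "{b \<in> maximal_exponents ?N. (\<Sum>i\<in>UNIV. Poly_Mapping.lookup b i) = j} =
      facet_exponent a ` {F \<in> facets \<Delta>. (\<Sum>i\<in>F. a i - 1) = j}" for j
  proof -
    have "(\<Sum>i\<in>UNIV. Poly_Mapping.lookup (facet_exponent a F) i) = (\<Sum>i\<in>F. a i - 1)" for F
      by (simp add: lookup_facet_exponent sum.If_cases)
    then show ?thesis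
      unfolding maximal by auto
  qed
  \<comment> \<open>Taking \<open>keys\<close> is a left inverse, so counting exponent vectors is
    the same as counting facets.\<close>
  moreover have "card (facet_exponent a ` \<F>) = card \<F>" for \<F>
    using keys_facet_exponent[OF assms(3)] by (intro card_image inj_onI) metis
  ultimately show ?thesis
    using generators unfolding I inverse_system_complement_ideal[OF down]
    by (simp add: minimal_generators_iff[OF down finite_standard_exponents])
qed

end
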